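(* Let $M$ be either of the adjacency, Laplacian, distance or distance Laplacian matrices. Two graphs $G$ and $H$ with $n$ vertices are $M$-cospectral if and only if they are $M_x^{\mathbb{Q}}$-codeterminantal.
   Context: Graphs are simple, finite and connected. For a graph $G$ with $n$ vertices: $A(G)$ is the adjacency matrix; $L(G)=\deg(G)-A(G)$ is the Laplacian, where $\deg(G)$ is the diagonal matrix of vertex degrees; $D(G)$ is the distance matrix (entry $(u,v)$ is the graph distance between $u$ and $v$); the distance Laplacian is $F(G)=T(G)-D(G)$, where $T(G)$ is the diagonal matrix of transmissions, the transmission of a vertex being the sum of its distances to all other vertices. For $M\in\{A,L,D,F\}$ put $M_x(G)=xI_n-M(G)$; $I_k^{\mathbb{Q}}(M_x(G))$ is the ideal of $\mathbb{Q}[x]$ generated by all $k\times k$ minors of $M_x(G)$. $G$ and $H$ are $M_x^{\mathbb{Q}}$-codeterminantal if $I_k^{\mathbb{Q}}(M_x(G))=I_k^{\mathbb{Q}}(M_x(H))$ for each $k\in\{1,\dots,n\}$. $G$ and $H$ are $M$-cospectral if $M(G)$ and $M(H)$ have the same spectrum (multiset of eigenvalues with multiplicities). *)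

theory Defs
  imports
    "HOL-Algebra.Ideal"
    "Graph_Theory.Graph_Theory"
    "Jordan_Normal_Form.Spectral_Radius"
    "Jordan_Normal_Form.DL_Submatrix"
begin

text \<open>
  A simple finite connected graph is a \<open>G\<close> with \<open>pair_graph G\<close> and
  \<open>Digraph_Component.connected (with_proj G)\<close>: every edge \<open>{u, v}\<close> is stored as the two arcs
  \<open>(u, v)\<close> and \<open>(v, u)\<close>, there are no loops, and connectedness includes that there is at least one
  vertex. Matrices are written with respect to a list \<open>vs\<close> enumerating the vertices.
\<close>

definition vertex_enum :: "'a pair_pre_digraph \<Rightarrow> 'a list \<Rightarrow> bool" where
  "vertex_enum G vs \<longleftrightarrow> distinct vs \<and> set vs = pverts G"

text \<open>The length of an arc walk is its number of arcs.\<close>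

definition graph_dist :: "'a pair_pre_digraph \<Rightarrow> 'a \<Rightarrow> 'a \<Rightarrow> nat" where
  "graph_dist G u v = (LEAST k. \<exists>p. pre_digraph.awalk (with_proj G) u p v \<and> length p = k)"

lemma (in pair_wf_digraph) graph_dist_eq_shortest_path:
  assumes "u \<rightarrow>\<^sup>*\<^bsub>with_proj G\<^esub> v"
  shows "ereal (real (graph_dist G u v)) = \<mu> (\<lambda>_. 1) u v"
proof -
  let ?P = "\<lambda>k. \<exists>p. awalk u p v \<and> length p = k"
  have cost: "awalk_cost (\<lambda>_. 1) p = real (length p)" for p :: "('a \<times> 'a) list"
    by (induction p) (auto simp: awalk_cost_def)
  obtain q where "awalk u q v"
    using assms by (auto simp: reachable_awalk)
  then have "?P (graph_dist G u v)"
    unfolding graph_dist_def by (intro LeastI[of ?P "length q"]) auto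
  then obtain p where p: "awalk u p v" "length p = graph_dist G u v"
    by blast
  have least: "graph_dist G u v \<le> length r" if "awalk u r v" for r
    unfolding graph_dist_def using that by (intro Least_le) auto
  show ?thesis
  proof (rule antisym)
    show "ereal (real (graph_dist G u v)) \<le> \<mu> (\<lambda>_. 1) u v"
      unfolding \<mu>_def by (rule INF_greatest) (simp add: cost least)
    show "\<mu> (\<lambda>_. 1) u v \<le> ereal (real (graph_dist G u v))"
      using min_cost_le_walk_cost[OF p(1), of "\<lambda>_. 1"] by (simp add: cost p(2))
  qed
qed

definition transmission :: "'a pair_pre_digraph \<Rightarrow> 'a \<Rightarrow> nat" where
  "transmission G v = (\<Sum>u\<in>pverts G - {v}. graph_dist G v u)"

definition adjacency_mat :: "'a pair_pre_digraph \<Rightarrow> 'a list \<Rightarrow> int mat" where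
  "adjacency_mat G vs =
     mat (length vs) (length vs) (\<lambda>(i, j). if (vs ! i, vs ! j) \<in> parcs G then 1 else 0)"

text \<open>For a symmetric digraph the degree of a vertex is its out-degree.\<close>

definition degree_mat :: "'a pair_pre_digraph \<Rightarrow> 'a list \<Rightarrow> int mat" where
  "degree_mat G vs = mat_diag (length vs) (\<lambda>i. int (out_degree (with_proj G) (vs ! i)))"

definition laplacian_mat :: "'a pair_pre_digraph \<Rightarrow> 'a list \<Rightarrow> int mat" where
  "laplacian_mat G vs = degree_mat G vs - adjacency_mat G vs"

definition distance_mat :: "'a pair_pre_digraph \<Rightarrow> 'a list \<Rightarrow> int mat" where
  "distance_mat G vs =
     mat (length vs) (length vs) (\<lambda>(i, j). int (graph_dist G (vs ! i) (vs ! j)))"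

definition transmission_mat :: "'a pair_pre_digraph \<Rightarrow> 'a list \<Rightarrow> int mat" where
  "transmission_mat G vs = mat_diag (length vs) (\<lambda>i. int (transmission G (vs ! i)))"

definition distance_laplacian_mat :: "'a pair_pre_digraph \<Rightarrow> 'a list \<Rightarrow> int mat" where
  "distance_laplacian_mat G vs = transmission_mat G vs - distance_mat G vs"

text \<open>The eigenvalues of a complex matrix, counted with algebraic multiplicity.\<close>

definition spectrum_mset :: "complex mat \<Rightarrow> complex multiset" where
  "spectrum_mset A = proots (char_poly A)"

lemma set_mset_spectrum_mset:
  assumes "A \<in> carrier_mat n n"
  shows "set_mset (spectrum_mset A) = spectrum A"
proof -
  have "char_poly A \<noteq> 0"
    using degree_monic_char_poly[OF assms] by auto
  then show ?thesis
    by (simp add: spectrum_mset_def spectrum_root_char_poly[OF assms])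
qed

definition cospectral :: "int mat \<Rightarrow> int mat \<Rightarrow> bool" where
  "cospectral A B \<longleftrightarrow>
     spectrum_mset (map_mat complex_of_int A) = spectrum_mset (map_mat complex_of_int B)"

definition minors :: "nat \<Rightarrow> 'r::comm_ring_1 mat \<Rightarrow> 'r set" where
  "minors k A = {det (submatrix A I J) | I J.
     I \<subseteq> {..<dim_row A} \<and> J \<subseteq> {..<dim_col A} \<and> card I = k \<and> card J = k}"

definition determinantal_ideal :: "nat \<Rightarrow> 'r::comm_ring_1 mat \<Rightarrow> 'r set" where
  "determinantal_ideal k A = Idl\<^bsub>class_ring\<^esub> (minors k A)"

text \<open>\<open>char_poly_matrix A\<close> is the matrix \<open>x I - A\<close>, here over \<open>rat poly\<close>, that is \<open>\<rat>[x]\<close>.\<close>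

definition codeterminantal :: "nat \<Rightarrow> int mat \<Rightarrow> int mat \<Rightarrow> bool" where
  "codeterminantal n A B \<longleftrightarrow> (\<forall>k\<in>{1..n}.
     determinantal_ideal k (char_poly_matrix (map_mat rat_of_int A)) =
     determinantal_ideal k (char_poly_matrix (map_mat rat_of_int B)))"

end

theory Submission
  imports Defs "Jordan_Normal_Form.Jordan_Normal_Form_Uniqueness"
begin

text \<open>
  All four matrices are symmetric with integer entries, and the equivalence holds for any two such
  matrices \<open>A\<close> and \<open>B\<close> of the same positive size \<open>n\<close>.

  The ideal of \<open>n \<times> n\<close> minors of \<open>x I - A\<close> is generated by the characteristic polynomial of
  \<open>A\<close>. Since characteristic polynomials are monic, codeterminantal matrices have the same
  characteristic polynomial and therefore the same spectrum.

  Conversely, a real symmetric matrix is diagonalizable, so that cospectral matrices \<open>A\<close> and \<open>B\<close>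
  are similar to the same diagonal matrix, hence to each other, over the complex numbers
  (\<open>hermitian_similar_of_spectrum_eq\<close>). Then \<open>x I - A = P (x I - B) Q\<close> for constant matrices
  \<open>P\<close> and \<open>Q\<close>, and by the Cauchy--Binet argument every common divisor of the \<open>k \<times> k\<close> minors of
  \<open>x I - B\<close> divides those of \<open>x I - A\<close> (\<open>similar_dvd_minors\<close>). It remains to come down from
  \<open>\<complex>[x]\<close> to \<open>\<rat>[x]\<close>. Ideals of \<open>\<rat>[x]\<close> are principal, so each determinantal ideal consists of
  the multiples of one rational polynomial, and divisibility between rational polynomials does not
  depend on the field over which it is tested (\<open>determinantal_ideal_mono\<close>). Exchanging the roles
  of \<open>A\<close> and \<open>B\<close> gives the equality of the ideals.
\<close>

section \<open>Minors of products and of images\<close>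

text \<open>
  The rows selected by an arbitrary map \<open>f\<close>, in any order and possibly with repetitions, give either
  a determinant with two equal rows or a permuted minor. This is the form in which minors appear when
  the determinant of a product is expanded.
\<close>

lemma dvd_det_of_dvd_minors:
  fixes X :: "'a::comm_ring_1 mat"
  assumes d: "\<And>m. m \<in> minors k X \<Longrightarrow> d dvd m"
    and f: "\<And>i. i < k \<Longrightarrow> f i < dim_row X"
    and J: "J \<subseteq> {..<dim_col X}" "card J = k"
  shows "d dvd det (mat k k (\<lambda>(i, j). X $$ (f i, pick J j)))" (is "d dvd det ?M")
proof (cases "inj_on f {0..<k}")
  case False
  then obtain i j where ij: "i < k" "j < k" "i \<noteq> j" "f i = f j"
    by (auto simp: inj_on_def)
  have "det ?M = 0"
  proof (rule det_identical_rows[OF _ ij(3) ij(1) ij(2)])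
    show "row ?M i = row ?M j" using ij by (intro eq_vecI) auto
  qed auto
  then show ?thesis by simp
next
  case True
  let ?I = "f ` {0..<k}"
  have cI: "card ?I = k" using True by (simp add: card_image)
  have sI: "?I \<subseteq> {..<dim_row X}" using f by auto
  have inj_pick: "inj_on (pick ?I) {0..<k}"
  proof (rule inj_onI)
    fix a b assume "a \<in> {0..<k}" "b \<in> {0..<k}" "pick ?I a = pick ?I b"
    then show "a = b"
      using pick_mono_le[of a ?I b] pick_mono_le[of b ?I a] cI
      by (cases a b rule: linorder_cases) auto
  qed
  have "pick ?I ` {0..<k} \<subseteq> ?I" using pick_in_set_le[of _ ?I] cI by fastforce
  then have bp: "bij_betw (pick ?I) {0..<k} ?I"
    using inj_pick cI card_subset_eq[of ?I "pick ?I ` {0..<k}"]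
    by (simp add: bij_betw_def card_image)
  have bf: "bij_betw f {0..<k} ?I" using True by (simp add: bij_betw_def)
  \<comment> \<open>\<open>q\<close> is the permutation that sorts the rows selected by \<open>f\<close>.\<close>
  define q where "q = (\<lambda>i. if i < k then the_inv_into {0..<k} (pick ?I) (f i) else i)"
  have "bij_betw (the_inv_into {0..<k} (pick ?I) \<circ> f) {0..<k} {0..<k}"
    by (rule bij_betw_trans[OF bf bij_betw_the_inv_into[OF bp]])
  then have "bij_betw q {0..<k} {0..<k}"
    by (rule iffD1[OF bij_betw_cong, rotated]) (auto simp: q_def)
  then have q: "q permutes {0..<k}"
    by (rule bij_imp_permutes) (auto simp: q_def)
  have fq: "pick ?I (q i) = f i" if "i < k" for i
    using f_the_inv_into_f_bij_betw[OF bp, of "f i"] that by (auto simp: q_def)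
  have qk: "q i < k" if "i < k" for i using permutes_in_image[OF q, of i] that by auto
  let ?N = "mat k k (\<lambda>(i, j). X $$ (pick ?I i, pick J j))"
  have "?M = mat k k (\<lambda>(i, j). ?N $$ (q i, j))"
    by (rule eq_matI) (auto simp: fq qk)
  then have "det ?M = signof q * det ?N"
    using det_permute_rows[OF _ q, of ?N] by simp
  moreover have "{i. i < dim_row X \<and> i \<in> ?I} = ?I" "{j. j < dim_col X \<and> j \<in> J} = J"
    using sI J(1) by auto
  then have "?N = submatrix X ?I J"
    unfolding submatrix_def using J cI by simp
  then have "det ?N \<in> minors k X"
    unfolding minors_def using J cI sI by auto
  ultimately show ?thesis using d by simp
qed

text \<open>
  The part of the Cauchy--Binet formula that ideals can see. A row of a submatrix of \<open>P * X\<close> is a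
  linear combination of rows of \<open>X\<close>, so by multilinearity the minor is a linear combination of
  determinants of rows selected from \<open>X\<close>. Divisibility by one element replaces membership in an
  ideal; this suffices for principal ideals, and it survives an extension of the coefficients.
\<close>

lemma dvd_minors_mult_left:
  fixes X :: "'a::comm_ring_1 mat"
  assumes P: "P \<in> carrier_mat m n" and X: "X \<in> carrier_mat n l"
    and d: "\<And>x. x \<in> minors k X \<Longrightarrow> d dvd x"
    and x: "x \<in> minors k (P * X)"
  shows "d dvd x"
proof -
  from x P X obtain I J where I: "I \<subseteq> {..<m}" "card I = k" and J: "J \<subseteq> {..<l}" "card J = k"
    and xIJ: "x = det (submatrix (P * X) I J)"
    unfolding minors_def by auto
  have IJ: "{i. i < m \<and> i \<in> I} = I" "{j. j < l \<and> j \<in> J} = J" using I J by auto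
  have pI: "pick I i < m" if "i < k" for i using pick_in_set_le[of i I] I that by auto
  have pJ: "pick J i < l" if "i < k" for i using pick_in_set_le[of i J] J that by auto
  let ?r = "\<lambda>a. vec k (\<lambda>j. X $$ (a, pick J j))"
  let ?F = "{f. (\<forall>i\<in>{0..<k}. f i \<in> {0..<n}) \<and> (\<forall>i. i \<notin> {0..<k} \<longrightarrow> f i = i)}"
  have "submatrix (P * X) I J = mat\<^sub>r k k (\<lambda>i. finsum_vec TYPE('a) k
      (\<lambda>a. P $$ (pick I i, a) \<cdot>\<^sub>v ?r a) {0..<n})"
    using P X IJ pI pJ I J
    by (intro eq_matI) (auto simp: submatrix_def scalar_prod_def index_finsum_vec)
  then have "x = (\<Sum>f\<in>?F. det (mat\<^sub>r k k (\<lambda>i. P $$ (pick I i, f i) \<cdot>\<^sub>v ?r (f i))))"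
    unfolding xIJ by (simp add: det_linear_rows_sum)
  also have "\<dots> = (\<Sum>f\<in>?F. (\<Prod>i\<in>{0..<k}. P $$ (pick I i, f i)) * det (mat\<^sub>r k k (\<lambda>i. ?r (f i))))"
    by (intro sum.cong refl det_rows_mul) auto
  also have "d dvd \<dots>"
  proof (intro dvd_sum dvd_mult)
    fix f assume f: "f \<in> ?F"
    have "mat\<^sub>r k k (\<lambda>i. ?r (f i)) = mat k k (\<lambda>(i, j). X $$ (f i, pick J j))"
      by (rule eq_matI) auto
    also have "d dvd det \<dots>"
      by (rule dvd_det_of_dvd_minors) (use f X J d in auto)
    finally show "d dvd det (mat\<^sub>r k k (\<lambda>i. ?r (f i)))" .
  qed
  finally show ?thesis .
qed

lemma minors_transpose: "minors k (transpose_mat X) = minors k X"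
proof -
  have sub: "minors k (transpose_mat X) \<subseteq> minors k X" for X :: "'a::comm_ring_1 mat"
  proof
    fix x assume "x \<in> minors k (transpose_mat X)"
    then obtain I J where IJ: "I \<subseteq> {..<dim_col X}" "J \<subseteq> {..<dim_row X}" "card I = k" "card J = k"
      and x: "x = det (submatrix (transpose_mat X) I J)"
      unfolding minors_def by auto
    have eq: "{i. i < dim_col X \<and> i \<in> I} = I" "{j. j < dim_row X \<and> j \<in> J} = J" using IJ by auto
    have "pick I i < dim_col X" if "i < k" for i using pick_in_set_le[of i I] IJ that by auto
    moreover have "pick J i < dim_row X" if "i < k" for i using pick_in_set_le[of i J] IJ that by auto
    ultimately have "submatrix (transpose_mat X) I J = transpose_mat (submatrix X J I)"
      using IJ by (intro eq_matI) (auto simp: submatrix_def eq)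
    moreover have "submatrix X J I \<in> carrier_mat k k"
      using IJ by (auto simp: submatrix_def eq)
    ultimately have "x = det (submatrix X J I)" using x by (simp add: det_transpose)
    then show "x \<in> minors k X" unfolding minors_def using IJ by blast
  qed
  from sub[of X] sub[of "transpose_mat X"] show ?thesis by simp
qed

lemma dvd_minors_mult_right:
  fixes X :: "'a::comm_ring_1 mat"
  assumes X: "X \<in> carrier_mat m n" and Q: "Q \<in> carrier_mat n l"
    and d: "\<And>x. x \<in> minors k X \<Longrightarrow> d dvd x"
    and x: "x \<in> minors k (X * Q)"
  shows "d dvd x"
proof (rule dvd_minors_mult_left)
  show "x \<in> minors k (transpose_mat Q * transpose_mat X)"
    using x minors_transpose[of k "X * Q"] transpose_mult[OF X Q] by simp
  show "\<And>x. x \<in> minors k (transpose_mat X) \<Longrightarrow> d dvd x"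
    using d by (simp add: minors_transpose)
qed (use X Q in auto)

lemma minors_top:
  assumes "X \<in> carrier_mat n n"
  shows "minors n X = {det X}"
proof -
  have "pick {..<n} i = i" if "i < n" for i
  proof -
    have "{a \<in> {..<n}. a < i} = {..<i}" using that by auto
    then show ?thesis using pick_card_in_set[of i "{..<n}"] that by simp
  qed
  then have "submatrix X {..<n} {..<n} = X"
    using assms by (intro eq_matI) (auto simp: submatrix_def)
  moreover have full: "I = {..<n}" if "I \<subseteq> {..<n}" "card I = n" for I
    using that by (intro card_subset_eq) auto
  then have "minors n X = {det (submatrix X {..<n} {..<n})}"
  proof (intro equalityI subsetI)
    fix x assume "x \<in> minors n X"
    then obtain I J where "I \<subseteq> {..<n}" "J \<subseteq> {..<n}" "card I = n" "card J = n"
      and x: "x = det (submatrix X I J)"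
      unfolding minors_def using assms by auto
    then have "I = {..<n}" "J = {..<n}" by (simp_all only: full)
    then show "x \<in> {det (submatrix X {..<n} {..<n})}" by (simp only: x singletonI)
  next
    fix x assume "x \<in> {det (submatrix X {..<n} {..<n})}"
    then show "x \<in> minors n X"
      unfolding minors_def using assms by (auto intro!: exI[of _ "{..<n}"])
  qed
  ultimately show ?thesis by simp
qed

text \<open>
  Minors are polynomial expressions in the entries. This moves them from \<open>\<rat>[x]\<close> to \<open>\<complex>[x]\<close>.
\<close>

lemma minors_hom:
  assumes "comm_ring_hom h"
  shows "minors k (map_mat h X) = h ` minors k X"
proof -
  interpret comm_ring_hom h by fact
  have *: "det (submatrix (map_mat h X) I J) = h (det (submatrix X I J))"
    if "I \<subseteq> {..<dim_row X}" "J \<subseteq> {..<dim_col X}" for I J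
  proof -
    have IJ: "{i. i < dim_row X \<and> i \<in> I} = I" "{j. j < dim_col X \<and> j \<in> J} = J" using that by auto
    have "pick I i < dim_row X" if "i < card I" for i
      using pick_in_set_le[OF that] \<open>I \<subseteq> _\<close> by auto
    moreover have "pick J i < dim_col X" if "i < card J" for i
      using pick_in_set_le[OF that] \<open>J \<subseteq> _\<close> by auto
    ultimately have "submatrix (map_mat h X) I J = map_mat h (submatrix X I J)"
      by (intro eq_matI) (auto simp: submatrix_def IJ)
    then show ?thesis by simp
  qed
  show ?thesis
  proof (intro equalityI subsetI)
    fix x assume "x \<in> minors k (map_mat h X)"
    then obtain I J where IJ: "I \<subseteq> {..<dim_row X}" "J \<subseteq> {..<dim_col X}" "card I = k" "card J = k"
      and x: "x = det (submatrix (map_mat h X) I J)"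
      unfolding minors_def by auto
    have "det (submatrix X I J) \<in> minors k X" unfolding minors_def using IJ by blast
    then show "x \<in> h ` minors k X" using x *[OF IJ(1,2)] by simp
  next
    fix x assume "x \<in> h ` minors k X"
    then obtain I J where IJ: "I \<subseteq> {..<dim_row X}" "J \<subseteq> {..<dim_col X}" "card I = k" "card J = k"
      and x: "x = h (det (submatrix X I J))"
      unfolding minors_def by auto
    then have "x = det (submatrix (map_mat h X) I J)" by (simp only: *[OF IJ(1,2)])
    moreover have "I \<subseteq> {..<dim_row (map_mat h X)}" "J \<subseteq> {..<dim_col (map_mat h X)}"
      using IJ by auto
    ultimately show "x \<in> minors k (map_mat h X)"
      unfolding minors_def using IJ(3,4) by blast
  qed
qed

section \<open>Ideals of polynomials in one variable\<close>

text \<open>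
  Division with remainder: a nonzero member of least degree divides all the others.
\<close>

lemma Idl_poly_principal:
  fixes S :: "'a::field poly set"
  shows "\<exists>g\<in>Idl\<^bsub>class_ring\<^esub> S. \<forall>s\<in>Idl\<^bsub>class_ring\<^esub> S. g dvd s"
proof -
  let ?I = "Idl\<^bsub>class_ring\<^esub> S"
  interpret I: ideal ?I class_ring
    by (rule ring.genideal_ideal[OF class_ring.ring_axioms]) auto
  have sub: "s - g * q \<in> ?I" if "s \<in> ?I" "g \<in> ?I" for s g q
  proof -
    have "g * (- q) \<in> ?I" using I.I_r_closed[OF that(2), of "- q"] by simp
    from I.a_closed[OF that(1) this] show ?thesis by simp
  qed
  show ?thesis
  proof (cases "?I \<subseteq> {0}")
    case True
    moreover have "0 \<in> ?I" using I.zero_closed by simp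
    ultimately show ?thesis by (intro bexI[of _ 0]) auto
  next
    case False
    then obtain s where "s \<in> ?I \<and> s \<noteq> 0" by auto
    then obtain g where g: "g \<in> ?I" "g \<noteq> 0"
      and min: "\<And>s. s \<in> ?I \<Longrightarrow> s \<noteq> 0 \<Longrightarrow> degree g \<le> degree s"
      using ex_has_least_nat[of "\<lambda>s. s \<in> ?I \<and> s \<noteq> 0" s degree] by blast
    have "g dvd s" if "s \<in> ?I" for s
    proof (rule ccontr)
      assume nd: "\<not> g dvd s"
      then have "s mod g \<noteq> 0" by (simp add: mod_eq_0_iff_dvd)
      moreover have "s mod g \<in> ?I"
        using sub[OF that g(1), of "s div g"] by (simp add: minus_mult_div_eq_mod)
      ultimately have "degree g \<le> degree (s mod g)" by (intro min)
      moreover have "degree (s mod g) < degree g"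
        using degree_mod_less'[OF g(2)] \<open>s mod g \<noteq> 0\<close> by blast
      ultimately show False by simp
    qed
    then show ?thesis using g(1) by (intro bexI[of _ g] ballI)
  qed
qed

text \<open>
  A generator of a principal ideal of polynomials is determined up to a constant factor, and
  monicity fixes that factor.
\<close>

lemma monic_Idl_singleton_eq:
  fixes p q :: "'a::field poly"
  assumes "Idl\<^bsub>class_ring\<^esub> {p} = Idl\<^bsub>class_ring\<^esub> {q}" "monic p" "monic q"
  shows "p = q"
proof -
  have cr: "cring (class_ring :: 'a poly ring)" by (rule class_cring.cring_axioms)
  have "p dvd q" if "Idl\<^bsub>class_ring\<^esub> {p} = Idl\<^bsub>class_ring\<^esub> {q}" for p q :: "'a poly"
  proof -
    have "q \<in> Idl\<^bsub>class_ring\<^esub> {q}" by (rule ring.genideal_self'[OF class_ring.ring_axioms]) simp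
    then have "q \<in> PIdl\<^bsub>class_ring\<^esub> p"
      using cring.cgenideal_eq_genideal[OF cr, of p] that by simp
    then show ?thesis by (auto simp: cgenideal_def)
  qed
  then have "p dvd q" "q dvd p" using assms(1) by (metis, metis)
  then show ?thesis using assms(2,3) 
    by (metis poly_dvd_antisym)
qed

section \<open>Spectral theorem for Hermitian matrices\<close>

lemma hermitian_cscalar_prod:
  fixes A :: "complex mat"
  assumes A: "A \<in> carrier_mat n n"
    and herm: "\<And>i j. i < n \<Longrightarrow> j < n \<Longrightarrow> A $$ (i, j) = cnj (A $$ (j, i))"
    and x: "x \<in> carrier_vec n" and y: "y \<in> carrier_vec n"
  shows "(A *\<^sub>v x) \<bullet>c y = x \<bullet>c (A *\<^sub>v y)"
proof -
  have "(A *\<^sub>v x) \<bullet>c y = (\<Sum>i<n. \<Sum>j<n. A $$ (i, j) * x $ j * cnj (y $ i))"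
    using A x y by (simp add: scalar_prod_def sum_distrib_right atLeast0LessThan)
  also have "\<dots> = (\<Sum>j<n. \<Sum>i<n. A $$ (i, j) * x $ j * cnj (y $ i))"
    by (rule sum.swap)
  also have "\<dots> = (\<Sum>j<n. \<Sum>i<n. x $ j * (cnj (A $$ (j, i)) * cnj (y $ i)))"
  proof (intro sum.cong refl)
    fix j i assume "j \<in> {..<n}" "i \<in> {..<n}"
    then have "A $$ (i, j) = cnj (A $$ (j, i))" by (intro herm) auto
    then show "A $$ (i, j) * x $ j * cnj (y $ i) = x $ j * (cnj (A $$ (j, i)) * cnj (y $ i))"
      by (simp only: mult_ac)
  qed
  also have "\<dots> = x \<bullet>c (A *\<^sub>v y)"
    using A x y by (simp add: scalar_prod_def sum_distrib_left atLeast0LessThan)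
  finally show ?thesis .
qed

lemma char_matrix_mult_vec:
  fixes A :: "'a::field mat"
  assumes "A \<in> carrier_mat n n" "v \<in> carrier_vec n"
  shows "char_matrix A a *\<^sub>v v = A *\<^sub>v v - a \<cdot>\<^sub>v v"
  using assms by (intro eq_vecI) (auto simp: char_matrix_def add_scalar_prod_distrib[of _ n])

text \<open>
  For a Hermitian matrix, generalized eigenvectors of rank 2 are eigenvectors. With
  \<open>w = (A - a I) v\<close> nonzero and \<open>A w = a w\<close>, the eigenvalue \<open>a\<close> is real, and then
  \<open>\<langle>w, w\<rangle> = \<langle>(A - a I) v, w\<rangle> = \<langle>v, (A - a I) w\<rangle> = 0\<close>.
\<close>

lemma hermitian_eigenspace_generalized:
  fixes A :: "complex mat"
  assumes A: "A \<in> carrier_mat n n"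
    and herm: "\<And>i j. i < n \<Longrightarrow> j < n \<Longrightarrow> A $$ (i, j) = cnj (A $$ (j, i))"
    and v: "v \<in> carrier_vec n"
    and sq: "char_matrix A a *\<^sub>v (char_matrix A a *\<^sub>v v) = 0\<^sub>v n"
  shows "char_matrix A a *\<^sub>v v = 0\<^sub>v n"
proof (rule ccontr)
  define w where "w = char_matrix A a *\<^sub>v v"
  assume "\<not> ?thesis"
  then have w0: "w \<noteq> 0\<^sub>v n" by (simp add: w_def)
  have w: "w \<in> carrier_vec n" using A v by (simp add: w_def mult_mat_vec_carrier[of _ n n])
  have wv: "w = A *\<^sub>v v - a \<cdot>\<^sub>v v" using A v by (simp add: w_def char_matrix_mult_vec)
  have diff: "A *\<^sub>v w - a \<cdot>\<^sub>v w = 0\<^sub>v n"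
    using sq A w by (simp add: w_def[symmetric] char_matrix_mult_vec)
  have Aw: "A *\<^sub>v w = a \<cdot>\<^sub>v w"
  proof (rule eq_vecI)
    fix i assume "i < dim_vec (a \<cdot>\<^sub>v w)"
    then have i: "i < n" using w by simp
    then have "(A *\<^sub>v w - a \<cdot>\<^sub>v w) $ i = 0" by (simp add: diff)
    then show "(A *\<^sub>v w) $ i = (a \<cdot>\<^sub>v w) $ i" using i A w by simp
  qed (use A w in simp)
  have ww: "w \<bullet>c w \<noteq> 0" using w w0 by simp
  have "(A *\<^sub>v w) \<bullet>c w = w \<bullet>c (A *\<^sub>v w)" by (rule hermitian_cscalar_prod[OF A herm w w])
  then have "a * (w \<bullet>c w) = cnj a * (w \<bullet>c w)"
    using w by (simp add: Aw conjugate_smult_vec)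
  with ww have real: "cnj a = a" by simp
  have "w \<bullet>c w = (A *\<^sub>v v) \<bullet>c w - (a \<cdot>\<^sub>v v) \<bullet>c w"
    using A v w by (subst (1) wv) (rule minus_scalar_prod_distrib[of _ n], auto)
  also have "\<dots> = v \<bullet>c (A *\<^sub>v w) - a * (v \<bullet>c w)"
    using hermitian_cscalar_prod[OF A herm v w] v w by simp
  also have "\<dots> = 0" using v w by (simp add: Aw conjugate_smult_vec real)
  finally show False using ww by simp
qed

lemma jordan_matrix_blocks_1: "jordan_matrix (map (Pair 1) es) = mat_diag (length es) ((!) es)"
proof (induction es)
  case Nil
  then show ?case by (intro eq_matI) (auto simp: jordan_matrix_def mat_diag_def)
next
  case (Cons e es)
  have len: "sum_list (map (fst \<circ> Pair (Suc 0)) es) = length es" by (induction es) auto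
  show ?case
    unfolding list.map jordan_matrix_Cons Cons.IH
    by (intro eq_matI)
       (auto simp: len mat_diag_def nth_Cons' less_Suc_eq_0_disj split: if_splits)
qed

text \<open>
  The spectral theorem, as far as similarity is concerned, read off from the Jordan normal form. The
  kernel of \<open>(A - a I)\<^sup>2\<close> exceeds that of \<open>A - a I\<close> by one dimension for every Jordan block
  for \<open>a\<close> of size at least 2, and the two kernels coincide here; so all blocks have size 1.
\<close>

lemma hermitian_diagonalizable:
  fixes A :: "complex mat"
  assumes A: "A \<in> carrier_mat n n"
    and herm: "\<And>i j. i < n \<Longrightarrow> j < n \<Longrightarrow> A $$ (i, j) = cnj (A $$ (j, i))"
  obtains es where "similar_mat A (mat_diag (length es) ((!) es))" "proots (char_poly A) = mset es"
proof -
  from char_poly_factorized[OF A] obtain as where "char_poly A = (\<Prod>a\<leftarrow>as. [:- a, 1:])" by blast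
  from jordan_nf_exists[OF A this] obtain nas where jnf: "jordan_nf A nas" by blast
  have dims: "dim_gen_eigenspace A a 1 = dim_gen_eigenspace A a 2" for a :: complex
  proof -
    let ?C = "char_matrix A a"
    have C: "?C \<in> carrier_mat n n" using A by simp
    have sq: "?C ^\<^sub>m 2 *\<^sub>v v = ?C *\<^sub>v (?C *\<^sub>v v)" if "v \<in> carrier_vec n" for v
      using C that by (simp add: numeral_2_eq_2)
    have "mat_kernel (?C ^\<^sub>m 1) = mat_kernel (?C ^\<^sub>m 2)"
    proof (intro equalityI subsetI)
      fix v assume "v \<in> mat_kernel (?C ^\<^sub>m 1)"
      then have "v \<in> carrier_vec n" "?C *\<^sub>v v = 0\<^sub>v n" using C by (auto simp: mat_kernel_def)
      moreover have "?C *\<^sub>v 0\<^sub>v n = 0\<^sub>v n" using C by auto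
      ultimately show "v \<in> mat_kernel (?C ^\<^sub>m 2)" using C sq by (auto simp: mat_kernel_def)
    next
      fix v assume "v \<in> mat_kernel (?C ^\<^sub>m 2)"
      then have v: "v \<in> carrier_vec n" and "?C *\<^sub>v (?C *\<^sub>v v) = 0\<^sub>v n"
        using C sq by (auto simp: mat_kernel_def)
      then have "?C *\<^sub>v v = 0\<^sub>v n"
        using hermitian_eigenspace_generalized[OF A herm] by blast
      then show "v \<in> mat_kernel (?C ^\<^sub>m 1)" using v C by (auto simp: mat_kernel_def)
    qed
    then show ?thesis using C by (simp add: dim_gen_eigenspace_def kernel_dim_def)
  qed
  have size1: "m = 1" if "(m, a) \<in> set nas" for m a
  proof (rule ccontr)
    assume "m \<noteq> 1"
    moreover have "m \<noteq> 0" using jnf that by (force simp: jordan_nf_def)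
    ultimately have m: "min 1 m = 1" "min 2 m = 2" by auto
    let ?ms = "map fst [(k, e)\<leftarrow>nas. e = a]"
    have "m \<in> set ?ms" using that by force
    then obtain xs ys where split: "?ms = xs @ m # ys" by (meson split_list)
    have "sum_list (map (min 1) xs) \<le> sum_list (map (min 2) xs)" for xs :: "nat list"
      by (intro sum_list_mono) auto
    from this[of xs] this[of ys] m have "sum_list (map (min 1) ?ms) < sum_list (map (min 2) ?ms)"
      unfolding split by (simp add: m[simplified])
    then show False using dims[of a] dim_gen_eigenspace[OF jnf] by simp
  qed
  define es where "es = map snd nas"
  have "nas = map (Pair 1) es"
    unfolding es_def map_map by (rule map_idI[symmetric]) (use size1 in force)
  then have J: "jordan_matrix nas = mat_diag (length es) ((!) es)"
    by (simp only: jordan_matrix_blocks_1)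
  have sim: "similar_mat A (mat_diag (length es) ((!) es))"
    using jnf J by (simp add: jordan_nf_def)
  have "char_poly A = (\<Prod>e\<leftarrow>es. [:- e, 1:])"
    unfolding jordan_nf_char_poly[OF jnf] \<open>nas = map (Pair 1) es\<close> by (simp add: comp_def)
  moreover have "proots (\<Prod>e\<leftarrow>es. [:- e, 1:]) = mset es"
  proof (induction es)
    case (Cons e es)
    have "(\<Prod>e\<leftarrow>es. [:- e, 1:]) \<noteq> 0" by (auto simp: prod_list_zero_iff)
    then have "[:- e, 1:] * (\<Prod>e\<leftarrow>es. [:- e, 1:]) \<noteq> 0" by (simp del: mult_pCons_left)
    then show ?case using Cons.IH by (simp add: proots_mult del: mult_pCons_left)
  qed simp
  ultimately show ?thesis using that sim by simp
qed

text \<open>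
  Reordering the diagonal is conjugation by a permutation matrix. This makes the multiset of
  eigenvalues decide similarity of diagonalizable matrices, although the Jordan normal form only provides them in some order.
\<close>

lemma similar_mat_diag_permute:
  fixes es :: "'a::field list"
  assumes "mset es = mset fs"
  shows "similar_mat (mat_diag (length es) ((!) es)) (mat_diag (length fs) ((!) fs))"
proof -
  define n where "n = length fs"
  have len: "length es = n" using assms by (metis mset_eq_length n_def)
  from assms obtain p where p: "p permutes {..<n}" and "permute_list p fs = es"
    unfolding n_def by (rule mset_eq_permutation)
  then have nth: "es ! i = fs ! p i" if "i < n" for i
    using that permute_list_nth[of p fs i] by (auto simp: n_def)
  have pn: "p i < n" if "i < n" for i using permutes_in_image[OF p, of i] that by auto
  define P :: "'a mat" where "P = mat n n (\<lambda>(i, j). if p i = j then 1 else 0)"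
  let ?D = "mat_diag n ((!) es)" and ?E = "mat_diag n ((!) fs)"
  have carr: "P \<in> carrier_mat n n" "transpose_mat P \<in> carrier_mat n n" by (auto simp: P_def)
  have "inj p" using p by (rule permutes_inj)
  have PPt: "P * transpose_mat P = 1\<^sub>m n"
  proof (rule eq_matI)
    fix i j assume "i < dim_row (1\<^sub>m n)" "j < dim_col (1\<^sub>m n)"
    then have ij: "i < n" "j < n" by auto
    have "(P * transpose_mat P) $$ (i, j)
        = (\<Sum>k\<in>{0..<n}. (if p i = k then 1 else 0) * (if p j = k then 1 else 0))"
      using ij by (simp add: P_def scalar_prod_def)
    also have "\<dots> = (\<Sum>k\<in>{0..<n}. if k = p i then (if p j = p i then 1 else 0) else 0)"
      by (rule sum.cong) auto
    also have "\<dots> = (if i = j then 1 else 0)"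
      using pn[OF ij(1)] inj_eq[OF \<open>inj p\<close>, of j i] by auto
    finally show "(P * transpose_mat P) $$ (i, j) = 1\<^sub>m n $$ (i, j)" using ij by simp
  qed (use carr in auto)
  have "?D * P = P * ?E"
    unfolding mat_diag_mult_left[OF carr(1)] mat_diag_mult_right[OF carr(1)]
    by (rule eq_matI) (auto simp: P_def nth)
  then have "P * ?E * transpose_mat P = ?D * (P * transpose_mat P)"
    using carr assoc_mult_mat[of ?D n n P n "transpose_mat P" n] by simp
  also have "\<dots> = ?D" unfolding PPt by (rule right_mult_one_mat[OF mat_diag_dim])
  finally have "?D = P * ?E * transpose_mat P" ..
  moreover have "{?D, ?E, P, transpose_mat P} \<subseteq> carrier_mat n n" using carr by simp
  ultimately have "similar_mat ?D ?E"
    using PPt mat_mult_left_right_inverse[OF carr PPt] by (intro similar_matI)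
  then show ?thesis by (simp add: len n_def)
qed

lemma hermitian_similar_of_spectrum_eq:
  fixes A B :: "complex mat"
  assumes A: "A \<in> carrier_mat n n"
    and hermA: "\<And>i j. i < n \<Longrightarrow> j < n \<Longrightarrow> A $$ (i, j) = cnj (A $$ (j, i))"
    and B: "B \<in> carrier_mat n n"
    and hermB: "\<And>i j. i < n \<Longrightarrow> j < n \<Longrightarrow> B $$ (i, j) = cnj (B $$ (j, i))"
    and spec: "spectrum_mset A = spectrum_mset B"
  shows "similar_mat A B"
proof -
  from hermitian_diagonalizable[OF A hermA] obtain es
    where es: "similar_mat A (mat_diag (length es) ((!) es))" "proots (char_poly A) = mset es" .
  from hermitian_diagonalizable[OF B hermB] obtain fs
    where fs: "similar_mat B (mat_diag (length fs) ((!) fs))" "proots (char_poly B) = mset fs" .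
  have "mset es = mset fs" using es(2) fs(2) spec by (simp add: spectrum_mset_def)
  from similar_mat_trans[OF es(1) similar_mat_trans[OF similar_mat_diag_permute[OF this]
      similar_mat_sym[OF fs(1)]]]
  show ?thesis .
qed

section \<open>Determinantal ideals of similar matrices\<close>

text \<open>
  Similar matrices have equivalent characteristic matrices: if \<open>A = P B Q\<close> with \<open>P Q = I\<close>, then
  \<open>x I - A = P (x I - B) Q\<close>, where \<open>P\<close> and \<open>Q\<close> are read as matrices of constant polynomials.
\<close>

lemma char_poly_matrix_similar:
  fixes A B :: "'a::comm_ring_1 mat"
  assumes "similar_mat A B"
  obtains P Q n where "P \<in> carrier_mat n n" "Q \<in> carrier_mat n n" "B \<in> carrier_mat n n"
    "char_poly_matrix A = P * char_poly_matrix B * Q"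
proof -
  from similar_matD[OF assms] obtain n P Q where
    carr: "A \<in> carrier_mat n n" "B \<in> carrier_mat n n" "P \<in> carrier_mat n n" "Q \<in> carrier_mat n n"
    and PQ: "P * Q = 1\<^sub>m n" and AB: "A = P * B * Q" by auto
  let ?c = "map_mat (\<lambda>a::'a. [:a:])"
  let ?X = "[:0, 1:] \<cdot>\<^sub>m 1\<^sub>m n :: 'a poly mat"
  have neg: "map_mat (\<lambda>a::'a. [:- a:]) M = - ?c M" for M
    by (rule eq_matI) auto
  have cc: "?c P \<in> carrier_mat n n" "?c B \<in> carrier_mat n n" "?c Q \<in> carrier_mat n n"
    "?X \<in> carrier_mat n n" using carr by auto
  have "?c P * ?X * ?c Q = [:0, 1:] \<cdot>\<^sub>m (?c P * ?c Q)"
    using cc by (simp add: mult_smult_distrib[of _ n n _ n] mult_smult_assoc_mat[of _ n n _ n])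
  also have "?c P * ?c Q = ?c (1\<^sub>m n)"
    unfolding PQ[symmetric] by (rule map_poly_mult(1)[OF carr(3,4), symmetric])
  also have "?c (1\<^sub>m n) = 1\<^sub>m n" by (rule eq_matI) auto
  finally have X: "?c P * ?X * ?c Q = ?X" .
  have "?c A = ?c P * ?c B * ?c Q"
    unfolding AB using carr by (simp add: map_poly_mult(1)[of _ n n _ n])
  moreover have "char_poly_matrix B = ?X - ?c B" "char_poly_matrix A = ?X - ?c A"
    using carr cc unfolding char_poly_matrix_def neg by auto
  moreover have "?c P * (?X - ?c B) * ?c Q = ?c P * ?X * ?c Q - ?c P * ?c B * ?c Q"
    using cc by (simp add: mult_minus_distrib_mat[of _ n n _ n] minus_mult_distrib_mat[of _ n n _ _ n])
  ultimately have "char_poly_matrix A = ?c P * char_poly_matrix B * ?c Q" using X by simp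
  then show ?thesis by (rule that[OF cc(1,3) carr(2)])
qed

lemma similar_dvd_minors:
  fixes A B :: "'a::comm_ring_1 mat"
  assumes sim: "similar_mat A B"
    and d: "\<And>m. m \<in> minors k (char_poly_matrix B) \<Longrightarrow> d dvd m"
    and m: "m \<in> minors k (char_poly_matrix A)"
  shows "d dvd m"
proof -
  obtain P Q n where
    P: "P \<in> carrier_mat n n" and Q: "Q \<in> carrier_mat n n" and B: "B \<in> carrier_mat n n"
    and eq: "char_poly_matrix A = P * char_poly_matrix B * Q"
    by (rule char_poly_matrix_similar[OF sim])
  have cB: "char_poly_matrix B \<in> carrier_mat n n" using B by simp
  have "d dvd x" if "x \<in> minors k (P * char_poly_matrix B)" for x
    by (rule dvd_minors_mult_left[OF P cB d that])
  from dvd_minors_mult_right[OF mult_carrier_mat[OF P cB] Q this m[unfolded eq]]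
  show ?thesis .
qed

text \<open>
  Descent from \<open>\<complex>\<close> to \<open>\<rat>\<close>. The ideal of \<open>B\<close> over \<open>\<rat>[x]\<close> is generated by a single
  polynomial \<open>g\<close>. Since similarity is only given over the complex numbers, \<open>g\<close> is first seen to
  divide the minors of \<open>A\<close> in \<open>\<complex>[x]\<close>; but division with remainder gives the same quotient and
  remainder over either field, so \<open>g\<close> divides them in \<open>\<rat>[x]\<close> as well.
\<close>

lemma determinantal_ideal_mono:
  fixes A B :: "rat mat"
  assumes A: "A \<in> carrier_mat n n" and B: "B \<in> carrier_mat n n"
    and sim: "similar_mat (map_mat complex_of_rat A) (map_mat complex_of_rat B)"
  shows "determinantal_ideal k (char_poly_matrix A) \<subseteq> determinantal_ideal k (char_poly_matrix B)"
proof -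
  let ?I = "Idl\<^bsub>class_ring\<^esub> (minors k (char_poly_matrix B))"
  let ?h = "map_poly complex_of_rat"
  interpret h: map_poly_comm_ring_hom complex_of_rat ..
  have hom: "minors k (char_poly_matrix (map_mat complex_of_rat M)) = ?h ` minors k (char_poly_matrix M)"
    if "M \<in> carrier_mat n n" for M
    unfolding of_rat_hom.char_poly_matrix_hom[OF that] by (rule minors_hom) unfold_locales
  obtain g where g: "g \<in> ?I" and gdvd: "\<And>s. s \<in> ?I \<Longrightarrow> g dvd s"
    using Idl_poly_principal[of "minors k (char_poly_matrix B)"] by (elim bexE) simp
  have sub: "minors k (char_poly_matrix B) \<subseteq> ?I"
    by (rule ring.genideal_self[OF class_ring.ring_axioms]) simp
  have dvd_B: "?h g dvd m" if "m \<in> minors k (char_poly_matrix (map_mat complex_of_rat B))" for m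
    using that sub gdvd by (auto simp: hom[OF B])
  have "minors k (char_poly_matrix A) \<subseteq> ?I"
  proof
    fix m assume "m \<in> minors k (char_poly_matrix A)"
    then have "?h m \<in> minors k (char_poly_matrix (map_mat complex_of_rat A))"
      by (simp add: hom[OF A])
    from similar_dvd_minors[OF sim dvd_B this] have "?h g dvd ?h m" .
    then have "g dvd m" by (rule of_rat_hom.dvd_map_poly_hom_imp_dvd)
    then obtain q where m: "m = g * q" by (elim dvdE)
    have "ideal ?I class_ring"
      by (rule ring.genideal_ideal[OF class_ring.ring_axioms]) simp
    from ideal.I_r_closed[OF this g, of q] show "m \<in> ?I" by (simp add: m)
  qed
  moreover have "ideal ?I class_ring"
    by (rule ring.genideal_ideal[OF class_ring.ring_axioms]) simp
  ultimately show ?thesis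
    unfolding determinantal_ideal_def
    by (intro ring.genideal_minimal[OF class_ring.ring_axioms])
qed

section \<open>Symmetry of the graph matrices\<close>

lemma (in pair_sym_digraph) awalk_reverse:
  assumes "awalk u p v"
  shows "\<exists>q. awalk v q u \<and> length q = length p"
  using assms
proof (induction p arbitrary: u)
  case Nil
  then show ?case by (auto simp: awalk_Nil_iff)
next
  case (Cons e es)
  then have e: "e \<in> parcs G" "fst e = u" and "awalk (snd e) es v"
    by (auto simp: awalk_Cons_iff)
  then obtain q where q: "awalk v q (snd e)" "length q = length es"
    using Cons.IH by blast
  have rev_arc: "(snd e, fst e) \<in> parcs G" using e by (auto intro: arcs_symmetric)
  then have "awalk (snd e) [(snd e, fst e)] u"
    using e by (auto simp: awalk_simps dest: wellformed')
  with q have "awalk v (q @ [(snd e, fst e)]) u" by (blast intro: awalk_appendI)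
  then show ?case using q by (intro exI[of _ "q @ [(snd e, fst e)]"]) simp
qed

lemma (in pair_sym_digraph) graph_dist_commute: "graph_dist G u v = graph_dist G v u"
proof -
  have "(\<exists>p. awalk u p v \<and> length p = k) \<longleftrightarrow> (\<exists>p. awalk v p u \<and> length p = k)" for k
    using awalk_reverse by metis
  then show ?thesis by (simp add: graph_dist_def)
qed

text \<open>
  Adjacency and distance are symmetric in the two vertices of an undirected graph, and the
  Laplacians differ from minus these matrices only on the diagonal.
\<close>

lemma (in pair_sym_digraph) graph_matrices_symmetric:
  assumes "M \<in> {adjacency_mat, laplacian_mat, distance_mat, distance_laplacian_mat}"
  shows "M G vs \<in> carrier_mat (length vs) (length vs)" (is ?carrier)
    and "transpose_mat (M G vs) = M G vs" (is ?symm)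
proof -
  have arc: "(u, v) \<in> parcs G \<longleftrightarrow> (v, u) \<in> parcs G" for u v
    by (auto intro: arcs_symmetric)
  note defs = adjacency_mat_def laplacian_mat_def distance_mat_def distance_laplacian_mat_def
    degree_mat_def transmission_mat_def mat_diag_def
  show ?carrier using assms by (auto simp: defs)
  show ?symm using assms graph_dist_commute
    by (elim insertE emptyE; intro eq_matI) (auto simp: defs arc)
qed

section \<open>Cospectral and codeterminantal matrices\<close>

text \<open>
  In the direction from ideals to spectra only the largest ideal matters: the one minor of size \<open>n\<close>
  of \<open>x I - A\<close> is the characteristic polynomial.
\<close>

lemma cospectral_iff_codeterminantal:
  assumes A: "A \<in> carrier_mat n n" and symA: "transpose_mat A = A"
    and B: "B \<in> carrier_mat n n" and symB: "transpose_mat B = B"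
    and n: "n > 0"
  shows "cospectral A B \<longleftrightarrow> codeterminantal n A B"
proof
  let ?Q = "map_mat rat_of_int" and ?C = "map_mat complex_of_int"
  have CQ: "map_mat complex_of_rat (?Q M) = ?C M" for M
    by (rule eq_matI) auto
  {
    assume cos: "cospectral A B"
    have herm: "?C M $$ (i, j) = cnj (?C M $$ (j, i))"
      if "M \<in> carrier_mat n n" "transpose_mat M = M" "i < n" "j < n" for M i j
      using that index_transpose_mat(1)[of i M j] by simp
    have sim: "similar_mat (?C A) (?C B)"
      by (rule hermitian_similar_of_spectrum_eq[of _ n])
        (use A B symA symB herm cos in \<open>auto simp: cospectral_def\<close>)
    have "determinantal_ideal k (char_poly_matrix (?Q A)) =
        determinantal_ideal k (char_poly_matrix (?Q B))" for k
      using determinantal_ideal_mono[of "?Q A" n "?Q B" k]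
        determinantal_ideal_mono[of "?Q B" n "?Q A" k] sim similar_mat_sym[OF sim] A B
      by (simp add: CQ)
    then show "codeterminantal n A B" by (simp add: codeterminantal_def)
  }
  assume "codeterminantal n A B"
  then have "determinantal_ideal n (char_poly_matrix (?Q A)) =
      determinantal_ideal n (char_poly_matrix (?Q B))"
    using n by (simp add: codeterminantal_def)
  moreover have "minors n (char_poly_matrix (?Q M)) = {char_poly (?Q M)}"
    if "M \<in> carrier_mat n n" for M
    using that by (simp add: minors_top[of _ n] char_poly_def)
  ultimately have "Idl\<^bsub>class_ring\<^esub> {char_poly (?Q A)} = Idl\<^bsub>class_ring\<^esub> {char_poly (?Q B)}"
    using A B by (simp add: determinantal_ideal_def)
  moreover have "monic (char_poly (?Q M))" if "M \<in> carrier_mat n n" for M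
    using degree_monic_char_poly[of "?Q M" n] that by simp
  ultimately have "char_poly (?Q A) = char_poly (?Q B)"
    using A B by (intro monic_Idl_singleton_eq)
  moreover have "char_poly (?C M) = map_poly complex_of_rat (char_poly (?Q M))"
    if "M \<in> carrier_mat n n" for M
    unfolding CQ[symmetric] by (rule of_rat_hom.char_poly_hom[of _ n]) (use that in simp)
  ultimately show "cospectral A B" using A B by (simp add: cospectral_def spectrum_mset_def)
qed

theorem theorem33:
  fixes M :: "'a pair_pre_digraph \<Rightarrow> 'a list \<Rightarrow> int mat"
    and G H :: "'a pair_pre_digraph"
    and vs ws :: "'a list"
    and n :: nat
  assumes "M \<in> {adjacency_mat, laplacian_mat, distance_mat, distance_laplacian_mat}"
    and "pair_graph G" and "Digraph_Component.connected (with_proj G)"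
    and "pair_graph H" and "Digraph_Component.connected (with_proj H)"
    and "card (pverts G) = n" and "card (pverts H) = n"
    and "vertex_enum G vs" and "vertex_enum H ws"
  shows "cospectral (M G vs) (M H ws) \<longleftrightarrow> codeterminantal n (M G vs) (M H ws)"
proof -
  interpret G: pair_graph G by fact
  interpret H: pair_graph H by fact
  have len: "length vs = n" "length ws = n"
    using assms(6-9) distinct_card[of vs] distinct_card[of ws] by (auto simp: vertex_enum_def)
  have "pverts G \<noteq> {}"
    using assms(3) by (auto simp: connected_def strongly_connected_def)
  then have "n > 0" using assms(6) G.pair_finite_verts by (auto simp: card_gt_0_iff)
  then show ?thesis
    using G.graph_matrices_symmetric[OF assms(1), of vs] H.graph_matrices_symmetric[OF assms(1), of ws] len
    by (intro cospectral_iff_codeterminantal) auto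
qed

end
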